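(* Let $T$ be a positive operator on a Banach lattice $E$ and assume that $T$ is mean ergodic with mean ergodic projection $0$. Then every power $T^m$, $m\in\mathbb{N}=\{1,2,3,\dots\}$, is also mean ergodic with mean ergodic projection $0$.
   Context: "Operator" means linear operator. An operator on a Banach lattice $E$ is positive if it maps the positive cone $E_+$ into itself. A bounded linear operator $T$ on a Banach space $X$ is called mean ergodic if the limit $Px := \lim_{n\to\infty}\frac{1}{n}\sum_{k=0}^{n-1}T^k x$ exists (in norm) for every $x\in X$; the resulting operator $P$ is called the mean ergodic projection of $T$. Thus "$T$ is mean ergodic with mean ergodic projection $0$" means that $\frac{1}{n}\sum_{k=0}^{n-1}T^k x \to 0$ in norm for every $x\in X$. *)

theory Defs
  imports "HOL-Analysis.Analysis" "HOL-Library.Lattice_Algebras"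
begin

class banach_lattice = banach + ordered_real_vector + lattice_ab_group_add_abs +
  assumes norm_mono_abs: "\<bar>x\<bar> \<le> \<bar>y\<bar> \<Longrightarrow> norm x \<le> norm y"

instance real :: banach_lattice
  by standard simp

definition positive_operator :: "('a::banach_lattice \<Rightarrow> 'a) \<Rightarrow> bool" where
  "positive_operator T \<longleftrightarrow> linear T \<and> (\<forall>x. 0 \<le> x \<longrightarrow> 0 \<le> T x)"

(* The value at n = 0 is a junk value (0) and does not affect limits. *)
definition cesaro_mean :: "('a::real_normed_vector \<Rightarrow> 'a) \<Rightarrow> nat \<Rightarrow> 'a \<Rightarrow> 'a" where
  "cesaro_mean T n x = (1 / real n) *\<^sub>R (\<Sum>k<n. (T ^^ k) x)"

definition mean_ergodic :: "('a::banach \<Rightarrow> 'a) \<Rightarrow> bool" where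
  "mean_ergodic T \<longleftrightarrow> bounded_linear T \<and> (\<forall>x. convergent (\<lambda>n. cesaro_mean T n x))"

(* Meaningful only if T is mean ergodic: lim is unspecified on divergent sequences. *)
definition mean_ergodic_projection :: "('a::banach \<Rightarrow> 'a) \<Rightarrow> 'a \<Rightarrow> 'a" where
  "mean_ergodic_projection T x = lim (\<lambda>n. cesaro_mean T n x)"

end

(* For x \<ge> 0, positivity of T gives
   0 \<le> x + T^m x + ... + T^(m(n-1)) x \<le> x + T x + ... + T^(mn-1) x,
   so the n-th Cesaro mean of T^m at x has norm at most m times that of the (mn)-th Cesaro mean
   of T at x. Every vector is a difference of two positive ones. *)

theory Submission
  imports Defs
begin

lemma bounded_linear_funpow:
  fixes T :: "'a::real_normed_vector \<Rightarrow> 'a"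
  assumes "bounded_linear T"
  shows "bounded_linear (T ^^ m)"
proof (induction m)
  case 0
  show ?case by (simp add: id_def bounded_linear_ident)
next
  case (Suc m)
  show ?case using bounded_linear_compose[OF assms Suc] by (simp add: o_def)
qed

lemma positive_operator_funpow_nonneg:
  assumes "positive_operator T" "0 \<le> x"
  shows "0 \<le> (T ^^ k) x"
  using assms by (induction k) (auto simp: positive_operator_def)

lemma norm_mono_nonneg:
  fixes x y :: "'a::banach_lattice"
  assumes "0 \<le> x" "x \<le> y"
  shows "norm x \<le> norm y"
proof -
  have "0 \<le> y" using assms by (rule order_trans)
  then show ?thesis using assms by (intro norm_mono_abs) (simp add: abs_of_nonneg)
qed

lemma norm_cesaro_mean_funpow_le:
  fixes T :: "'a::banach_lattice \<Rightarrow> 'a"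
  assumes T: "positive_operator T" and x: "0 \<le> x" and m: "1 \<le> m"
  shows "norm (cesaro_mean (T ^^ m) n x) \<le> real m * norm (cesaro_mean T (m * n) x)"
proof -
  note nonneg = positive_operator_funpow_nonneg[OF T x]
  have pow: "((T ^^ m) ^^ k) x = (T ^^ (m * k)) x" for k
    by (simp add: funpow_mult)
  \<comment> \<open>Since m \<ge> 1, multiplication by m is injective, so the exponents m * k are
    distinct and the sum runs over a set of indices.\<close>
  have "(\<Sum>k<n. (T ^^ (m * k)) x) = (\<Sum>j\<in>(\<lambda>k. m * k) ` {..<n}. (T ^^ j) x)"
    using m by (subst sum.reindex) (auto simp: inj_on_def)
  \<comment> \<open>These indices all lie below m * n, and the terms added to fill the gaps are
    nonnegative.\<close>
  also have "\<dots> \<le> (\<Sum>j<m * n. (T ^^ j) x)"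
    using m by (intro sum_mono2) (auto simp: nonneg)
  finally have "norm (\<Sum>k<n. (T ^^ (m * k)) x) \<le> norm (\<Sum>j<m * n. (T ^^ j) x)"
    by (intro norm_mono_nonneg sum_nonneg nonneg)
  then show ?thesis
    \<comment> \<open>The factor m comes from 1 / n = m * (1 / (m * n)). For n = 0 both sides are
      0.\<close>
    using m by (simp add: cesaro_mean_def pow divide_right_mono)
qed

lemma cesaro_mean_diff:
  assumes "bounded_linear T"
  shows "cesaro_mean T n (x - y) = cesaro_mean T n x - cesaro_mean T n y"
proof -
  have "(T ^^ k) (x - y) = (T ^^ k) x - (T ^^ k) y" for k
    using bounded_linear_funpow[OF assms, of k] by (intro linear_diff bounded_linear.linear)
  then show ?thesis
    by (simp add: cesaro_mean_def sum_subtractf scaleR_right_diff_distrib)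
qed

text \<open>The equation for the projection carries information only together with convergence, as
  \<open>lim\<close> is unspecified on divergent sequences. The two conditions jointly amount to
  convergence of the means to 0.\<close>

lemma mean_ergodic_zero_iff:
  fixes T :: "'a::banach \<Rightarrow> 'a"
  shows "mean_ergodic T \<and> mean_ergodic_projection T = (\<lambda>x. 0) \<longleftrightarrow>
     bounded_linear T \<and> (\<forall>x. (\<lambda>n. cesaro_mean T n x) \<longlonglongrightarrow> 0)"
proof -
  have "convergent X \<and> lim X = 0 \<longleftrightarrow> X \<longlonglongrightarrow> 0" for X :: "nat \<Rightarrow> 'a"
    by (metis convergent_LIMSEQ_iff convergentI limI)
  then show ?thesis
    unfolding mean_ergodic_def mean_ergodic_projection_def fun_eq_iff by blast
qed

theorem theorem4p1:
  fixes T :: "'a::banach_lattice \<Rightarrow> 'a"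
  assumes "positive_operator T"
    and "mean_ergodic T"
    and "mean_ergodic_projection T = (\<lambda>x. 0)"
  shows "\<forall>m::nat. 1 \<le> m \<longrightarrow>
           mean_ergodic (T ^^ m) \<and> mean_ergodic_projection (T ^^ m) = (\<lambda>x. 0)"
proof (intro allI impI)
  fix m :: nat
  assume m: "1 \<le> m"
  have T: "bounded_linear T" and lim: "\<And>x. (\<lambda>n. cesaro_mean T n x) \<longlonglongrightarrow> 0"
    using assms(2,3) mean_ergodic_zero_iff[of T] by auto
  have Tm: "bounded_linear (T ^^ m)"
    using T by (rule bounded_linear_funpow)
  have pos: "(\<lambda>n. cesaro_mean (T ^^ m) n x) \<longlonglongrightarrow> 0" if x: "0 \<le> x" for x
  proof (rule Lim_null_comparison)
    show "\<forall>\<^sub>F n in sequentially.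
        norm (cesaro_mean (T ^^ m) n x) \<le> real m * norm (cesaro_mean T (m * n) x)"
      using norm_cesaro_mean_funpow_le[OF assms(1) x m] by simp
    \<comment> \<open>The means at the indices m * n form a subsequence of the Cesaro means of T, so
      they inherit the limit 0.\<close>
    have "strict_mono (\<lambda>n. m * n)"
      using m by (simp add: strict_mono_def)
    from LIMSEQ_subseq_LIMSEQ[OF lim this]
    have "(\<lambda>n. cesaro_mean T (m * n) x) \<longlonglongrightarrow> 0"
      by (simp add: o_def)
    then show "(\<lambda>n. real m * norm (cesaro_mean T (m * n) x)) \<longlonglongrightarrow> 0"
      by (intro tendsto_mult_right_zero tendsto_norm_zero)
  qed
  have "(\<lambda>n. cesaro_mean (T ^^ m) n x) \<longlonglongrightarrow> 0" for x
  proof -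
    \<comment> \<open>\<open>nprt x\<close> is the infimum of x and 0, hence \<le> 0. Its negation
      is the usual negative part, so both terms of the difference lie in the positive cone and
      \<open>pos\<close> applies to each.\<close>
    have "x = pprt x - (- nprt x)"
      using prts[of x] by simp
    moreover have "(\<lambda>n. cesaro_mean (T ^^ m) n (pprt x - (- nprt x))) \<longlonglongrightarrow> 0 - 0"
      unfolding cesaro_mean_diff[OF Tm] by (intro tendsto_diff pos) simp_all
    ultimately show ?thesis
      by simp
  qed
  with Tm show "mean_ergodic (T ^^ m) \<and> mean_ergodic_projection (T ^^ m) = (\<lambda>x. 0)"
    using mean_ergodic_zero_iff by blast
qed

end
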